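(* Let $A$ be a nonzero real symmetric positive-semidefinite $n\times n$ matrix, $\underline{\boldsymbol{x}}\sim N(\underline 0,I_n)$, $\boldsymbol{\Delta}=\underline{\boldsymbol{x}}^{\mathsf T}A\underline{\boldsymbol{x}}-\mathrm{tr}(A)$, and put $\alpha=\|A\|$, $\beta=\|A\|_2^2$. For $\frac23<a<1$ let $$b=\frac{3a-2}{a(2a-1)},\qquad c=\frac{3a-2}{2(1-a)^2}.$$ Then for every $t>0$, $\Pr(\boldsymbol{\Delta}>t)\le e^{\Lambda(t,a)}$, where $$\Lambda(t,a)=\begin{cases}-\dfrac{t}{2a\alpha}+\dfrac{\beta}{2a^2\alpha^2}\Big(\sqrt{1+\dfrac{2a\alpha t}{\beta}}-1\Big), & \dfrac{\alpha t}{\beta}\le c,\\[2mm] -\dfrac{bt}{2\alpha}+\dfrac{b^2\beta}{4(1-ab)\alpha^2}, & \dfrac{\alpha t}{\beta}>c.\end{cases}$$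
   Context: $\|A\|$ is the operator norm of $A$ and $\|A\|_2$ is its Hilbert-Schmidt (Frobenius) norm. *)

theory Defs
  imports "HOL-Probability.Probability"
begin

definition std_gaussian_density :: "real ^ 'n \<Rightarrow> real" where
  "std_gaussian_density v = (2 * pi) powr (- real CARD('n) / 2) * exp (- (norm v)\<^sup>2 / 2)"

definition pos_semidef :: "real ^ 'n ^ 'n \<Rightarrow> bool" where
  "pos_semidef A \<longleftrightarrow> transpose A = A \<and> (\<forall>v. 0 \<le> v \<bullet> (A *v v))"

definition op_norm :: "real ^ 'n ^ 'n \<Rightarrow> real" where
  "op_norm A = onorm (\<lambda>v. A *v v)"

definition hs_norm :: "real ^ 'n ^ 'n \<Rightarrow> real" where
  "hs_norm A = sqrt (\<Sum>i\<in>UNIV. \<Sum>j\<in>UNIV. (A $ i $ j)\<^sup>2)"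

lemma hs_norm_eq_norm: "hs_norm A = norm A"
  by (simp add: hs_norm_def norm_vec_def L2_set_def sum_nonneg)

definition chaos :: "real ^ 'n ^ 'n \<Rightarrow> real ^ 'n \<Rightarrow> real" where
  "chaos A v = v \<bullet> (A *v v) - trace A"

definition b_coeff :: "real \<Rightarrow> real" where
  "b_coeff a = (3 * a - 2) / (a * (2 * a - 1))"

definition c_coeff :: "real \<Rightarrow> real" where
  "c_coeff a = (3 * a - 2) / (2 * (1 - a)\<^sup>2)"

definition Lambda :: "real \<Rightarrow> real \<Rightarrow> real \<Rightarrow> real \<Rightarrow> real" where
  "Lambda \<alpha> \<beta> t a =
    (if \<alpha> * t / \<beta> \<le> c_coeff a
     then - t / (2 * a * \<alpha>)
          + \<beta> / (2 * a\<^sup>2 * \<alpha>\<^sup>2) * (sqrt (1 + 2 * a * \<alpha> * t / \<beta>) - 1)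
     else - b_coeff a * t / (2 * \<alpha>)
          + (b_coeff a)\<^sup>2 * \<beta> / (4 * (1 - a * b_coeff a) * \<alpha>\<^sup>2))"

end

theory Submission
  imports Defs
begin

text \<open>
  The bound is Chernoff's method with an exponent of the form \<open>s = u / (2 \<alpha>)\<close>.
  Diagonalising \<open>A\<close> by an orthogonal matrix turns the chaos into
  \<open>\<Sum>i. l i * (y i)\<^sup>2 - l i\<close> for independent standard normal \<open>y i\<close>, because both the
  Gaussian density and Lebesgue measure are rotation invariant. Its exponential moment is
  therefore the product of the factors \<open>exp (- w i / 2) / sqrt (1 - w i)\<close>, where
  \<open>w i = 2 * s * l i = u * l i / \<alpha>\<close> (lemma \<open>gaussian_chaos_mgf\<close>).

  The eigenvalues lie in \<open>[0, \<alpha>]\<close>, so every \<open>w i\<close> lies in \<open>[0, u]\<close>. The number \<open>b\<close> is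
  exactly what makes the one-variable inequality
  \<open>- ln (1 - w) / 2 - w / 2 \<le> w\<^sup>2 / (4 * (1 - a * w))\<close> follow on \<open>[0, b]\<close> from the sign of a
  derivative (lemma \<open>neg_log_bound\<close>). Replacing \<open>a * w i\<close> by \<open>a * u\<close> in the denominator leaves only
  \<open>\<Sum>i. (l i)\<^sup>2 = \<beta>\<close>, and for every \<open>u\<close> in \<open>(0, b]\<close>
  the logarithm of the tail probability is at most
  \<open>- u * t / (2 * \<alpha>) + u\<^sup>2 * \<beta> / (4 * (1 - a * u) * \<alpha>\<^sup>2)\<close> (lemma \<open>chaos_Chernoff_bound\<close>).

  The unconstrained minimiser of this expression is \<open>(1 - 1 / r) / a\<close> with
  \<open>r = sqrt (1 + 2 * a * \<alpha> * t / \<beta>)\<close>. It is at most \<open>b\<close> precisely when \<open>\<alpha> * t / \<beta> \<le> c\<close>, and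
  its value is the first branch of \<open>Lambda\<close>; otherwise the endpoint \<open>u = b\<close> gives the second.
\<close>

section \<open>The scalar inequality and the optimal exponent\<close>

text \<open>
  The bound \<open>b < 1\<close> is the inequality \<open>0 < 2 * (1 - a)\<^sup>2\<close> in disguise.
\<close>
lemma b_coeff_bounds:
  assumes "2 / 3 < a" "a < 1"
  shows "0 < b_coeff a" "b_coeff a < 1" "1 - a * b_coeff a = (1 - a) / (2 * a - 1)"
proof -
  have p: "0 < a * (2 * a - 1)" using assms by simp
  show "0 < b_coeff a" using assms p by (simp add: b_coeff_def)
  have "0 < 2 * (1 - a)\<^sup>2" using assms by simp
  then have "3 * a - 2 < a * (2 * a - 1)" by (simp add: power2_eq_square algebra_simps)
  then show "b_coeff a < 1" using p by (simp add: b_coeff_def)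
  show "1 - a * b_coeff a = (1 - a) / (2 * a - 1)"
    using assms by (simp add: b_coeff_def field_simps)
qed

text \<open>
  The right-hand side minus the left-hand side vanishes at \<open>0\<close>, and its derivative has, for \<open>0 < u < 1\<close>, the sign of
  \<open>3 * a - 2 - a * (2 * a - 1) * u\<close>, whose zero is \<open>b_coeff a\<close>.
\<close>
lemma neg_log_bound:
  fixes a u :: real
  assumes a: "2 / 3 < a" "a < 1" and u: "0 \<le> u" "u \<le> b_coeff a"
  shows "- ln (1 - u) / 2 - u / 2 \<le> u\<^sup>2 / (4 * (1 - a * u))"
proof -
  define f where "f = (\<lambda>v::real. v\<^sup>2 / (4 * (1 - a * v)) + ln (1 - v) / 2 + v / 2)"
  note b = b_coeff_bounds[OF a]
  have "f 0 \<le> f u"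
  proof (rule DERIV_nonneg_imp_nondecreasing[OF u(1)])
    fix v assume v: "0 \<le> v" "v \<le> u"
    have v1: "v < 1" using v u b by linarith
    have av: "a * v < 1" using mult_strict_mono'[of a 1 v 1] v1 v a by simp
    have p: "0 < a * (2 * a - 1)" using a by simp
    have "a * (2 * a - 1) * v \<le> a * (2 * a - 1) * b_coeff a"
      using p v u by (intro mult_left_mono) auto
    also have "\<dots> = 3 * a - 2" using a by (simp add: b_coeff_def)
    finally have key: "0 \<le> 3 * a - 2 - a * (2 * a - 1) * v" by simp
    have D: "(f has_real_derivative
       ((2 * v * (4 * (1 - a * v)) - v\<^sup>2 * (4 * (- a))) / (4 * (1 - a * v))\<^sup>2 - 1 / (2 * (1 - v)) + 1 / 2)) (at v)"
      unfolding f_def using v1 av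
      by (auto intro!: derivative_eq_intros simp: power2_eq_square field_simps)
    have "(2 * v * (4 * (1 - a * v)) - v\<^sup>2 * (4 * (- a))) / (4 * (1 - a * v))\<^sup>2 - 1 / (2 * (1 - v)) + 1 / 2
       = v\<^sup>2 * (3 * a - 2 - a * (2 * a - 1) * v) / (4 * (1 - a * v)\<^sup>2 * (1 - v))"
      using v1 av by (simp add: divide_simps) (simp add: power2_eq_square algebra_simps)
    also have "\<dots> \<ge> 0"
      using key v1 by (intro divide_nonneg_nonneg mult_nonneg_nonneg) auto
    finally show "\<exists>y. DERIV f v :> y \<and> 0 \<le> y" using D by blast
  qed
  then show ?thesis by (simp add: f_def)
qed

text \<open>
  At \<open>u = (1 - 1 / r) / a\<close> one has \<open>1 - a * u = 1 / r\<close> and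
  \<open>\<alpha> * t / \<beta> = (r\<^sup>2 - 1) / (2 * a)\<close>; both sides then equal
  \<open>- (r - 1)\<^sup>2 * \<beta> / (4 * a\<^sup>2 * \<alpha>\<^sup>2)\<close>.
\<close>
lemma chernoff_exponent_at_minimiser:
  fixes \<alpha> \<beta> a t r u :: real
  assumes "0 < \<alpha>" "0 < \<beta>" "0 < a" "0 < t"
  defines "r \<equiv> sqrt (1 + 2 * a * \<alpha> * t / \<beta>)"
  defines "u \<equiv> (1 - 1 / r) / a"
  shows "- u * t / (2 * \<alpha>) + u\<^sup>2 * \<beta> / (4 * (1 - a * u) * \<alpha>\<^sup>2)
    = - t / (2 * a * \<alpha>) + \<beta> / (2 * a\<^sup>2 * \<alpha>\<^sup>2) * (r - 1)"
proof -
  have "0 < 2 * a * \<alpha> * t / \<beta>" using assms by simp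
  then have r1: "1 < r" and r2: "r\<^sup>2 = 1 + 2 * a * \<alpha> * t / \<beta>"
    by (auto simp: r_def)
  have t: "t = (r\<^sup>2 - 1) * \<beta> / (2 * a * \<alpha>)"
    using r2 assms by (simp add: field_simps)
  have "1 - a * u = 1 / r" using assms by (simp add: u_def)
  then show ?thesis
    using assms(1-3) r1 unfolding t u_def
    by (simp add: divide_simps) (simp add: power2_eq_square algebra_simps)
qed

text \<open>
  Write \<open>r\<close> for the square root below. Since \<open>1 - a * b_coeff a\<close> is the inverse of
  \<open>q = (2 * a - 1) / (1 - a)\<close>, the claim is \<open>r \<le> q\<close>, and \<open>c_coeff a\<close> is the value of \<open>\<tau>\<close> at which
  \<open>r = q\<close>.
\<close>
lemma chernoff_minimiser_le_b_coeff:
  fixes a \<tau> :: real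
  assumes a: "2 / 3 < a" "a < 1" and \<tau>: "0 < \<tau>" "\<tau> \<le> c_coeff a"
  shows "(1 - 1 / sqrt (1 + 2 * a * \<tau>)) / a \<le> b_coeff a"
proof -
  define q where "q = (2 * a - 1) / (1 - a)"
  have q: "0 < q" using a by (simp add: q_def)
  have "1 + 2 * a * \<tau> \<le> 1 + 2 * a * c_coeff a"
    using a \<tau> by simp
  also have "\<dots> = q\<^sup>2"
    using a by (simp add: q_def c_coeff_def divide_simps) (simp add: power2_eq_square algebra_simps)
  finally have "sqrt (1 + 2 * a * \<tau>) \<le> q"
    using q by (simp add: real_le_lsqrt)
  moreover have "0 < 1 + 2 * a * \<tau>" using a \<tau> by (simp add: add_pos_pos)
  ultimately have "1 / q \<le> 1 / sqrt (1 + 2 * a * \<tau>)"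
    by (intro divide_left_mono) (auto intro!: mult_pos_pos q)
  moreover have "1 / q = 1 - a * b_coeff a"
    using b_coeff_bounds[OF a] a by (simp add: q_def)
  ultimately show ?thesis using a by (simp add: field_simps)
qed

section \<open>Orthogonal diagonalisation of symmetric matrices\<close>

text \<open>
  A maximiser \<open>v\<close> of the Rayleigh quotient on the unit sphere of \<open>S\<close> is an eigenvector: with
  \<open>w = f v - \<mu> *\<^sub>R v\<close>, comparing \<open>v\<close> with \<open>v + e *\<^sub>R w\<close> for small \<open>e > 0\<close> would contradict
  maximality at first order in \<open>e\<close> unless \<open>w = 0\<close>.
\<close>
lemma self_adjoint_eigenvector_exists:
  fixes f :: "'a::euclidean_space \<Rightarrow> 'a"
  assumes lin: "linear f" and sym: "\<And>x y. f x \<bullet> y = x \<bullet> f y"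
    and S: "subspace S" and inv: "f ` S \<subseteq> S" and ne: "S \<noteq> {0}"
  obtains v \<mu> where "v \<in> S" "norm v = 1" "f v = \<mu> *\<^sub>R v"
proof -
  define K where "K = S \<inter> sphere 0 1"
  have "compact K"
    unfolding K_def using S by (simp add: closed_subspace closed_Int_compact)
  moreover obtain w where "w \<in> S" "w \<noteq> 0"
    using ne S subspace_0 by blast
  then have "w /\<^sub>R norm w \<in> K"
    using S by (simp add: K_def subspace_scale)
  moreover have "continuous_on K (\<lambda>x. x \<bullet> f x)"
    using lin by (intro continuous_intros linear_continuous_on) (simp add: linear_linear)
  ultimately obtain v where vK: "v \<in> K" and max: "\<And>y. y \<in> K \<Longrightarrow> y \<bullet> f y \<le> v \<bullet> f v"
    using continuous_attains_sup[of K "\<lambda>x. x \<bullet> f x"] by blast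
  define \<mu> where "\<mu> = v \<bullet> f v"
  have v: "v \<in> S" "norm v = 1" using vK by (auto simp: K_def)
  have bound: "y \<bullet> f y \<le> \<mu> * (y \<bullet> y)" if "y \<in> S" for y
  proof (cases "y = 0")
    case False
    then have "y /\<^sub>R norm y \<in> K" using that S by (simp add: K_def subspace_scale)
    from max[OF this] have "(y \<bullet> f y) / (norm y)\<^sup>2 \<le> \<mu>"
      using lin by (simp add: linear_cmul \<mu>_def power2_eq_square divide_inverse mult_ac)
    then show ?thesis using False by (simp add: divide_le_eq power2_norm_eq_inner)
  qed (use lin in \<open>simp add: linear_0\<close>)
  define w where "w = f v - \<mu> *\<^sub>R v"
  define k where "k = w \<bullet> w"
  have wS: "w \<in> S" unfolding w_def using v inv S by (auto intro: subspace_diff subspace_scale)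
  define C where "C = \<mu> * (w \<bullet> w) - w \<bullet> f w"
  have C: "0 \<le> C" using bound[OF wS] by (simp add: C_def)
  have quad: "2 * e * k \<le> e\<^sup>2 * C" for e
  proof -
    have "v + e *\<^sub>R w \<in> S" using v wS S by (simp add: subspace_add subspace_scale)
    note ineq = bound[OF this]
    have e1: "(v + e *\<^sub>R w) \<bullet> f (v + e *\<^sub>R w) = \<mu> + 2 * e * (w \<bullet> f v) + e\<^sup>2 * (w \<bullet> f w)"
      using lin sym[of v w]
      by (simp add: linear_add linear_cmul inner_add \<mu>_def power2_eq_square algebra_simps inner_commute)
    have e2: "(v + e *\<^sub>R w) \<bullet> (v + e *\<^sub>R w) = 1 + 2 * e * (w \<bullet> v) + e\<^sup>2 * (w \<bullet> w)"
      using v(2) by (simp add: inner_add power2_eq_square algebra_simps inner_commute norm_eq_1)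
    have e3: "w \<bullet> f v = k + \<mu> * (w \<bullet> v)"
      by (simp add: k_def w_def inner_diff algebra_simps)
    show ?thesis using ineq unfolding e1 e2 e3 by (simp add: C_def algebra_simps)
  qed
  have "k \<le> 0"
  proof (rule ccontr)
    assume "\<not> k \<le> 0"
    then have k: "0 < k" by simp
    \<comment> \<open>The step \<open>e = k / (C + 1)\<close> is so small that the linear term dominates.\<close>
    have "2 * (k / (C + 1)) * k \<le> (k / (C + 1))\<^sup>2 * C" by (rule quad)
    then have "2 * (C + 1) \<le> C" using k C
      by (simp add: power2_eq_square divide_simps split: if_splits)
    then show False using C by simp
  qed
  then have "w = 0" by (metis k_def antisym inner_eq_zero_iff inner_ge_zero)
  then show thesis using that[of v \<mu>] v by (simp add: w_def)
qed

text \<open>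
  The spectral theorem, by induction on the dimension: the orthogonal complement in \<open>S\<close> of an
  eigenvector is again invariant.
\<close>
lemma self_adjoint_orthonormal_eigenbasis:
  fixes f :: "'a::euclidean_space \<Rightarrow> 'a"
  assumes lin: "linear f" and sym: "\<And>x y. f x \<bullet> y = x \<bullet> f y"
  shows "subspace S \<Longrightarrow> f ` S \<subseteq> S \<Longrightarrow>
    \<exists>B \<subseteq> S. finite B \<and> card B = dim S \<and> pairwise orthogonal B \<and>
      (\<forall>v\<in>B. norm v = 1 \<and> (\<exists>\<mu>. f v = \<mu> *\<^sub>R v))"
proof (induction "dim S" arbitrary: S)
  case 0
  then show ?case by (intro exI[of _ "{}"]) auto
next
  case (Suc n)
  then have "S \<noteq> {0}" by auto
  with self_adjoint_eigenvector_exists[OF lin sym Suc.prems]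
  obtain v \<mu> where v: "v \<in> S" "norm v = 1" "f v = \<mu> *\<^sub>R v" by blast
  define T where "T = {y \<in> S. \<forall>x \<in> span {v}. orthogonal x y}"
  have T: "T = {y \<in> S. v \<bullet> y = 0}"
    by (auto simp: T_def orthogonal_def span_singleton)
  have "dim T + dim (span {v}) = dim S"
    unfolding T_def using v Suc.prems
    by (intro dim_subspace_orthogonal_to_vectors) (auto simp: span_minimal)
  moreover have "dim (span {v}) = 1" using v by (auto simp: dim_insert)
  ultimately have dimT: "n = dim T" using Suc.hyps by simp
  have "subspace T" using Suc.prems(1)
    by (auto simp: T subspace_def inner_add)
  moreover have "f ` T \<subseteq> T"
    using Suc.prems(2) v(3) by (auto simp: T sym[symmetric])
  ultimately obtain B where B: "B \<subseteq> T" "finite B" "card B = dim T" "pairwise orthogonal B"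
      "\<forall>v\<in>B. norm v = 1 \<and> (\<exists>\<mu>. f v = \<mu> *\<^sub>R v)"
    using Suc.hyps(1)[OF dimT] by blast
  have vB: "v \<notin> B" using B(1) v(2) by (auto simp: T)
  show ?case
  proof (intro exI[of _ "insert v B"] conjI)
    show "insert v B \<subseteq> S" using B(1) v by (auto simp: T)
    show "card (insert v B) = dim S" using B vB dimT Suc.hyps(2) by simp
    show "pairwise orthogonal (insert v B)"
      using B(1,4) by (auto simp: pairwise_insert T orthogonal_def inner_commute)
  qed (use B v in auto)
qed

definition diag_matrix :: "('n \<Rightarrow> real) \<Rightarrow> real ^ 'n ^ 'n" where
  "diag_matrix l = (\<chi> i j. if i = j then l i else 0)"

lemma symmetric_matrix_diagonalisation:
  fixes A :: "real ^ 'n ^ 'n"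
  assumes "transpose A = A"
  obtains Q :: "real ^ 'n ^ 'n" and l :: "'n \<Rightarrow> real"
  where "orthogonal_matrix Q"
    and "A = transpose Q ** diag_matrix l ** Q"
proof -
  have sym: "(A *v x) \<bullet> y = x \<bullet> (A *v y)" for x y
    using dot_lmul_matrix[of x A y] assms by (metis transpose_matrix_vector)
  obtain B :: "(real ^ 'n) set" where B: "finite B" "card B = CARD('n)" "pairwise orthogonal B"
      "\<And>v. v \<in> B \<Longrightarrow> norm v = 1 \<and> (\<exists>\<mu>. A *v v = \<mu> *\<^sub>R v)"
    using self_adjoint_orthonormal_eigenbasis[of "(*v) A" UNIV] sym by auto
  obtain q where q: "bij_betw q (UNIV :: 'n set) B"
    using B by (metis finite bij_betw_iff_card)
  then have qB: "q i \<in> B" for i by (auto simp: bij_betw_def)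
  have "\<forall>i. \<exists>m. A *v q i = m *\<^sub>R q i" using B(4) qB by blast
  then obtain l where l: "\<And>i. A *v q i = l i *\<^sub>R q i" by metis
  define Q :: "real ^ 'n ^ 'n" where "Q = (\<chi> i. q i)"
  have row: "row i Q = q i" for i by (simp add: Q_def row_def vec_eq_iff)
  have orth: "orthogonal_matrix Q"
    unfolding orthogonal_matrix_orthonormal_rows row
  proof (intro conjI allI impI)
    show "norm (q i) = 1" for i using B(4)[OF qB] by blast
    fix i j :: 'n
    assume "i \<noteq> j"
    then have "q i \<noteq> q j" using q by (simp add: bij_betw_def inj_eq)
    then show "orthogonal (q i) (q j)" using B(3) qB by (simp add: pairwise_def)
  qed
  have "A ** transpose Q = transpose Q ** diag_matrix l"
  proof (simp add: vec_eq_iff, intro allI)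
    fix i j
    have "(A ** transpose Q) $ i $ j = (A *v q j) $ i"
      by (simp add: Q_def matrix_matrix_mult_def matrix_vector_mult_def transpose_def)
    also have "\<dots> = (transpose Q ** diag_matrix l) $ i $ j"
      by (simp add: Q_def l diag_matrix_def matrix_matrix_mult_def transpose_def if_distrib cong: if_cong)
    finally show "(A ** transpose Q) $ i $ j
      = (transpose Q ** diag_matrix l) $ i $ j" .
  qed
  then have "A = transpose Q ** diag_matrix l ** Q"
    using orth by (metis matrix_mul_assoc matrix_mul_rid orthogonal_matrix)
  then show thesis using orth that by blast
qed

lemma quadratic_form_conjugate_diag:
  fixes Q :: "real ^ 'n ^ 'n"
  shows "v \<bullet> ((transpose Q ** diag_matrix l ** Q) *v v) = (\<Sum>i\<in>UNIV. l i * ((Q *v v) $ i)\<^sup>2)"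
proof -
  have "v \<bullet> ((transpose Q ** diag_matrix l ** Q) *v v) = v \<bullet> (transpose Q *v (diag_matrix l *v (Q *v v)))"
    by (simp add: matrix_vector_mul_assoc matrix_mul_assoc)
  also have "\<dots> = (Q *v v) \<bullet> (diag_matrix l *v (Q *v v))"
    by (metis dot_lmul_matrix transpose_matrix_vector transpose_transpose)
  also have "diag_matrix l *v y = (\<chi> i. l i * y $ i)" for y
    by (simp add: diag_matrix_def matrix_vector_mult_def vec_eq_iff if_distrib[where f="\<lambda>x. x * _"] cong: if_cong)
  finally show ?thesis
    by (simp add: inner_vec_def power2_eq_square mult_ac)
qed

lemma trace_conjugate_orthogonal:
  fixes Q B :: "real ^ 'n ^ 'n"
  assumes "orthogonal_matrix Q"
  shows "trace (transpose Q ** B ** Q) = trace B"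
proof -
  have "trace (transpose Q ** B ** Q) = trace (Q ** (transpose Q ** B))"
    by (rule trace_mul_sym)
  also have "Q ** (transpose Q ** B) = B"
    using assms by (simp add: matrix_mul_assoc orthogonal_matrix_def)
  finally show ?thesis .
qed

lemma trace_diag_matrix: "trace (diag_matrix l) = (\<Sum>i\<in>UNIV. l i)"
  by (simp add: trace_def diag_matrix_def)

lemma hs_norm_square_eq_trace: "(hs_norm A)\<^sup>2 = trace (transpose A ** A)"
proof -
  have "(hs_norm A)\<^sup>2 = (\<Sum>i\<in>UNIV. \<Sum>j\<in>UNIV. (A $ i $ j)\<^sup>2)"
    by (simp add: hs_norm_def sum_nonneg)
  also have "\<dots> = (\<Sum>j\<in>UNIV. \<Sum>i\<in>UNIV. (A $ i $ j)\<^sup>2)" by (rule sum.swap)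
  finally show ?thesis
    by (simp add: trace_def matrix_matrix_mult_def transpose_def power2_eq_square)
qed

lemma hs_norm_square_conjugate_diag:
  fixes Q :: "real ^ 'n ^ 'n"
  assumes Q: "orthogonal_matrix Q"
  shows "(hs_norm (transpose Q ** diag_matrix l ** Q))\<^sup>2 = (\<Sum>i\<in>UNIV. (l i)\<^sup>2)"
proof -
  let ?D = "diag_matrix l"
  have "transpose (transpose Q ** ?D ** Q) ** (transpose Q ** ?D ** Q)
      = transpose Q ** (transpose ?D ** ((Q ** transpose Q) ** (?D ** Q)))"
    by (simp add: matrix_transpose_mul matrix_mul_assoc)
  also have "\<dots> = transpose Q ** (transpose ?D ** ?D) ** Q"
    using Q by (simp add: orthogonal_matrix_def matrix_mul_assoc)
  also have "transpose ?D ** ?D = diag_matrix (\<lambda>i. (l i)\<^sup>2)"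
    by (simp add: vec_eq_iff diag_matrix_def matrix_matrix_mult_def transpose_def
        if_distrib[where f="\<lambda>x. x * _"] power2_eq_square cong: if_cong)
  finally show ?thesis
    by (simp add: hs_norm_square_eq_trace trace_conjugate_orthogonal[OF Q] trace_diag_matrix)
qed

text \<open>
  The diagonal entries are Rayleigh quotients of unit vectors, namely of the rows of \<open>Q\<close>.
  Positive semidefiniteness and the operator norm bound the spectrum through this fact.
\<close>
lemma conjugate_diag_Rayleigh:
  fixes Q :: "real ^ 'n ^ 'n"
  assumes Q: "orthogonal_matrix Q"
  obtains v where "norm v = 1" "v \<bullet> ((transpose Q ** diag_matrix l ** Q) *v v) = l i"
proof
  let ?v = "transpose Q *v axis i 1"
  have Qv: "Q *v ?v = axis i 1"
    using Q by (simp only: matrix_vector_mul_assoc orthogonal_matrix_def matrix_vector_mul_lid)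
  have "orthogonal_matrix (transpose Q)"
    using Q by (simp add: orthogonal_matrix_transpose)
  then have "orthogonal_transformation ((*v) (transpose Q))"
    by (simp add: orthogonal_transformation_matrix)
  then show "norm ?v = 1" by (simp add: orthogonal_transformation)
  show "?v \<bullet> ((transpose Q ** diag_matrix l ** Q) *v ?v) = l i"
    unfolding quadratic_form_conjugate_diag Qv
    by (simp add: axis_def if_distrib[where f="\<lambda>x. x\<^sup>2"] if_distrib[where f="(*) _"] cong: if_cong)
qed

lemma pos_semidef_spectrum:
  fixes A :: "real ^ 'n ^ 'n"
  assumes "pos_semidef A"
  obtains Q :: "real ^ 'n ^ 'n" and l :: "'n \<Rightarrow> real"
  where "orthogonal_matrix Q" "A = transpose Q ** diag_matrix l ** Q"
    and "\<And>i. 0 \<le> l i" "\<And>i. l i \<le> op_norm A"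
proof -
  have sym: "transpose A = A" and psd: "\<And>v. 0 \<le> v \<bullet> (A *v v)"
    using assms by (auto simp: pos_semidef_def)
  obtain Q :: "real ^ 'n ^ 'n" and l where Q: "orthogonal_matrix Q"
    and A: "A = transpose Q ** diag_matrix l ** Q"
    by (rule symmetric_matrix_diagonalisation[OF sym])
  have "0 \<le> l i \<and> l i \<le> op_norm A" for i
  proof -
    obtain v where v: "norm v = 1" "v \<bullet> (A *v v) = l i"
      by (rule conjugate_diag_Rayleigh[OF Q, of l i, folded A])
    have "v \<bullet> (A *v v) \<le> norm v * norm (A *v v)" by (rule norm_cauchy_schwarz)
    also have "\<dots> \<le> op_norm A"
      using onorm[OF matrix_vector_mul_bounded_linear[of A], of v] v(1)
      by (simp add: op_norm_def)
    finally show ?thesis using v(2) psd[of v] by simp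
  qed
  then show thesis using that[OF Q A] by blast
qed

lemma op_norm_pos: "A \<noteq> 0 \<Longrightarrow> 0 < op_norm A"
  unfolding op_norm_def onorm_pos_lt[OF matrix_vector_mul_bounded_linear]
  by (auto simp: matrix_eq[of A 0])

section \<open>Rotation invariance and Gaussian integrals\<close>

lemma nn_integral_lborel_translation:
  fixes c :: "'a::euclidean_space"
  assumes [measurable]: "f \<in> borel_measurable borel"
  shows "(\<integral>\<^sup>+x. f (c + x) \<partial>lborel) = (\<integral>\<^sup>+x. f x \<partial>lborel)"
proof -
  have "(\<integral>\<^sup>+x. f x \<partial>lborel) = (\<integral>\<^sup>+x. f x \<partial>distr lborel borel ((+) c))"
    by (simp add: lborel_distr_plus)
  also have "\<dots> = (\<integral>\<^sup>+x. f (c + x) \<partial>lborel)"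
    by (subst nn_integral_distr) auto
  finally show ?thesis by simp
qed

text \<open>
  Lebesgue measure is characterised by translation invariance up to a factor, and the
  unit ball, which \<open>T\<close> preserves, fixes that factor. Both ideas are carried out at once: let
  \<open>g\<close> be the indicator of the unit ball and \<open>C\<close> its volume. Then \<open>C * \<integral> f (T x)\<close> equals
  \<open>\<integral>\<integral> g y * f (y + T x)\<close>, since \<open>y = T z\<close> can be absorbed into \<open>x\<close>. Shifting \<open>y\<close> by \<open>T x\<close>
  gives \<open>\<integral>\<integral> g (y - T x) * f y\<close>, where the integral over \<open>x\<close> is again a ball volume,
  because \<open>T\<close> is an isometry.
\<close>
lemma nn_integral_lborel_orthogonal_transformation:
  fixes T :: "'a::euclidean_space \<Rightarrow> 'a"
  assumes T: "orthogonal_transformation T" and [measurable]: "f \<in> borel_measurable borel"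
  shows "(\<integral>\<^sup>+x. f (T x) \<partial>lborel) = (\<integral>\<^sup>+x. f x \<partial>lborel)"
proof -
  define g :: "'a \<Rightarrow> ennreal" where "g = indicator (ball 0 1)"
  define C :: ennreal where "C = ennreal (unit_ball_vol (real DIM('a)))"
  have C0: "C \<noteq> 0" "C \<noteq> top" using unit_ball_vol_pos[of "real DIM('a)"] by (auto simp: C_def simp del: unit_ball_vol_pos)
  have lin: "linear T" using T by (simp add: orthogonal_transformation_def)
  have [measurable]: "T \<in> borel \<rightarrow>\<^sub>M borel"
    using lin by (intro borel_measurable_continuous_onI linear_continuous_on) (simp add: linear_linear)
  have [measurable]: "g \<in> borel_measurable borel"
    unfolding g_def by (intro borel_measurable_indicator) simp
  have ball: "(\<integral>\<^sup>+x. g (x - z) \<partial>lborel) = C" for z :: 'a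
  proof -
    have "(\<lambda>x. g (x - z)) = indicator (ball z 1)"
      by (auto simp: g_def indicator_def dist_norm norm_minus_commute)
    then show ?thesis by (simp add: emeasure_ball C_def)
  qed
  have rotball: "(\<integral>\<^sup>+x. g (y - T x) \<partial>lborel) = C" for y
  proof -
    obtain z where z: "y = T z"
      using orthogonal_transformation_surj[OF T] by (auto simp: surj_def)
    have "norm (y - T x) = norm (x - z)" for x
    proof -
      have "norm (y - T x) = norm (T (z - x))" by (simp add: z linear_diff[OF lin])
      also have "\<dots> = norm (z - x)" using T by (simp add: orthogonal_transformation)
      finally show ?thesis by (simp add: norm_minus_commute)
    qed
    then have "g (y - T x) = g (x - z)" for x
      by (simp add: g_def indicator_def)
    then show ?thesis by (simp add: ball)
  qed
  have shift: "(\<integral>\<^sup>+y. g y * f (y + T x) \<partial>lborel) = (\<integral>\<^sup>+y. g (y - T x) * f y \<partial>lborel)" for x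
    using nn_integral_lborel_translation[of "\<lambda>y. g (y - T x) * f y" "T x"]
    by (simp add: add.commute)
  have "C * (\<integral>\<^sup>+x. f (T x) \<partial>lborel) = (\<integral>\<^sup>+y. g y * (\<integral>\<^sup>+x. f (T x) \<partial>lborel) \<partial>lborel)"
    using ball[of 0] by (simp add: nn_integral_multc)
  also have "\<dots> = (\<integral>\<^sup>+y. g y * (\<integral>\<^sup>+x. f (y + T x) \<partial>lborel) \<partial>lborel)"
  proof (intro nn_integral_cong, goal_cases)
    case (1 y)
    obtain z where z: "y = T z"
      using orthogonal_transformation_surj[OF T] by (auto simp: surj_def)
    have "(\<integral>\<^sup>+x. f (y + T x) \<partial>lborel) = (\<integral>\<^sup>+x. f (T (z + x)) \<partial>lborel)"
      by (simp add: z linear_add[OF lin])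
    also have "\<dots> = (\<integral>\<^sup>+x. f (T x) \<partial>lborel)"
      by (rule nn_integral_lborel_translation[of "\<lambda>x. f (T x)"]) measurable
    finally show ?case by simp
  qed
  also have "\<dots> = (\<integral>\<^sup>+y. (\<integral>\<^sup>+x. g y * f (y + T x) \<partial>lborel) \<partial>lborel)"
    by (simp add: nn_integral_cmult)
  also have "\<dots> = (\<integral>\<^sup>+x. (\<integral>\<^sup>+y. g y * f (y + T x) \<partial>lborel) \<partial>lborel)"
    by (rule lborel_pair.Fubini') measurable
  also have "\<dots> = (\<integral>\<^sup>+x. (\<integral>\<^sup>+y. g (y - T x) * f y \<partial>lborel) \<partial>lborel)"
    by (simp only: shift)
  also have "\<dots> = (\<integral>\<^sup>+y. (\<integral>\<^sup>+x. g (y - T x) * f y \<partial>lborel) \<partial>lborel)"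
    by (rule lborel_pair.Fubini') measurable
  also have "\<dots> = C * (\<integral>\<^sup>+y. f y \<partial>lborel)"
    by (simp add: nn_integral_multc rotball nn_integral_cmult)
  finally show ?thesis using C0 by (simp add: ennreal_mult_cancel_left)
qed

lemma nn_integral_lborel_vec_prod:
  fixes g :: "'n::finite \<Rightarrow> real \<Rightarrow> ennreal"
  assumes [measurable]: "\<And>i. g i \<in> borel_measurable borel"
  shows "(\<integral>\<^sup>+y. (\<Prod>i\<in>UNIV. g i (y $ i)) \<partial>(lborel :: (real ^ 'n) measure))
    = (\<Prod>i\<in>UNIV. \<integral>\<^sup>+z. g i z \<partial>lborel)"
proof -
  have bij: "bij_betw (\<lambda>i. axis i 1) UNIV (Basis :: (real ^ 'n) set)"
    unfolding bij_betw_def inj_on_def using axis_inverse by (auto simp: axis_eq_axis)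
  have "(\<Prod>i\<in>UNIV. g i (y $ i)) = (\<Prod>b\<in>Basis. g (axis_index b) (y \<bullet> b))" for y :: "real ^ 'n"
    by (subst prod.reindex_bij_betw[OF bij, symmetric]) (simp add: cart_eq_inner_axis)
  moreover have "(\<Prod>b\<in>(Basis :: (real ^ 'n) set). \<integral>\<^sup>+z. g (axis_index b) z \<partial>lborel)
      = (\<Prod>i\<in>UNIV. \<integral>\<^sup>+z. g i z \<partial>lborel)"
    by (subst prod.reindex_bij_betw[OF bij, symmetric]) simp
  moreover have "(\<integral>\<^sup>+y. (\<Prod>b\<in>Basis. g (axis_index b) (y \<bullet> b)) \<partial>(lborel :: (real ^ 'n) measure))
      = (\<Prod>b\<in>(Basis :: (real ^ 'n) set). \<integral>\<^sup>+z. g (axis_index b) z \<partial>lborel)"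
    by (rule nn_integral_lborel_prod) auto
  ultimately show ?thesis by simp
qed

text \<open>
  Up to its mass \<open>\<sigma> = 1 / sqrt (1 - 2 * s)\<close> the integrand is the centred normal density with
  standard deviation \<open>\<sigma>\<close>.
\<close>
lemma nn_integral_normal_exp_square:
  fixes s :: real
  assumes "2 * s < 1"
  shows "(\<integral>\<^sup>+z. ennreal (std_normal_density z * exp (s * z\<^sup>2)) \<partial>lborel)
    = ennreal (1 / sqrt (1 - 2 * s))"
proof -
  define \<sigma> where "\<sigma> = 1 / sqrt (1 - 2 * s)"
  have \<sigma>: "0 < \<sigma>" "\<sigma>\<^sup>2 = 1 / (1 - 2 * s)"
    using assms by (auto simp: \<sigma>_def power_divide)
  have "std_normal_density z * exp (s * z\<^sup>2) = \<sigma> * normal_density 0 \<sigma> z" for z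
  proof -
    have "exp (- z\<^sup>2 / 2) * exp (s * z\<^sup>2) = exp (- z\<^sup>2 / (2 * \<sigma>\<^sup>2))"
      using assms by (simp add: \<sigma> field_simps flip: exp_add)
    then show ?thesis
      using \<sigma>(1) by (simp add: std_normal_density_def normal_density_def real_sqrt_mult)
  qed
  then have "(\<integral>\<^sup>+z. ennreal (std_normal_density z * exp (s * z\<^sup>2)) \<partial>lborel)
      = ennreal \<sigma> * (\<integral>\<^sup>+z. ennreal (normal_density 0 \<sigma> z) \<partial>lborel)"
    using \<sigma> by (simp add: ennreal_mult nn_integral_cmult)
  also have "(\<integral>\<^sup>+z. ennreal (normal_density 0 \<sigma> z) \<partial>lborel) = 1"
    using \<sigma> by (simp add: nn_integral_eq_integral)
  finally show ?thesis by (simp add: \<sigma>_def)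
qed

lemma std_gaussian_density_eq_prod:
  fixes v :: "real ^ 'n"
  shows "std_gaussian_density v = (\<Prod>i\<in>UNIV. std_normal_density (v $ i))"
proof -
  have "(2 * pi) powr (- real CARD('n) / 2) = (1 / sqrt (2 * pi)) ^ CARD('n)"
    by (simp add: powr_half_sqrt[symmetric] powr_realpow[symmetric] powr_powr powr_minus_divide[symmetric])
  moreover have "exp (- (norm v)\<^sup>2 / 2) = (\<Prod>i\<in>UNIV. exp (- (v $ i)\<^sup>2 / 2))"
  proof -
    have "(norm v)\<^sup>2 = (\<Sum>i\<in>UNIV. (v $ i)\<^sup>2)"
      unfolding power2_norm_eq_inner inner_vec_def by (simp add: power2_eq_square)
    moreover have "- (\<Sum>i\<in>UNIV. (v $ i)\<^sup>2) / 2 = (\<Sum>i\<in>UNIV. - (v $ i)\<^sup>2 / 2)"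
      unfolding sum_negf[symmetric] sum_divide_distrib ..
    ultimately show ?thesis by (simp only: exp_sum[OF finite])
  qed
  ultimately show ?thesis
    unfolding std_gaussian_density_def std_normal_density_def prod.distrib by simp
qed

section \<open>Exponential moment and tail of the chaos\<close>

text \<open>
  In the coordinates \<open>y = Q *v v\<close> both the density and the exponential factor over the
  coordinates, which reduces the integral to one-dimensional Gaussian ones.
\<close>
lemma gaussian_chaos_mgf:
  fixes Q :: "real ^ 'n ^ 'n"
  assumes Q: "orthogonal_matrix Q" and A: "A = transpose Q ** diag_matrix l ** Q"
    and s: "\<And>i. 2 * (s * l i) < 1"
  shows "(\<integral>\<^sup>+v. ennreal (std_gaussian_density v) * ennreal (exp (s * chaos A v)) \<partial>lborel)
    = ennreal (\<Prod>i\<in>UNIV. exp (- (s * l i)) / sqrt (1 - 2 * (s * l i)))"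
proof -
  define g where "g = (\<lambda>i z. ennreal (exp (- (s * l i)) * (std_normal_density z * exp (s * l i * z\<^sup>2))))"
  have T: "orthogonal_transformation ((*v) Q)"
    using Q by (simp add: orthogonal_transformation_matrix)
  have norm: "norm (Q *v v) = norm v" for v
    using T by (simp add: orthogonal_transformation)
  have chaos: "chaos A v = (\<Sum>i\<in>UNIV. l i * ((Q *v v) $ i)\<^sup>2 - l i)" for v
    unfolding chaos_def A trace_conjugate_orthogonal[OF Q] quadratic_form_conjugate_diag
    by (simp add: trace_diag_matrix sum_subtractf)
  have factor: "(\<integral>\<^sup>+z. g i z \<partial>lborel) = ennreal (exp (- (s * l i)) / sqrt (1 - 2 * (s * l i)))" for i
  proof -
    have "(\<integral>\<^sup>+z. g i z \<partial>lborel) = ennreal (exp (- (s * l i))) *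
        (\<integral>\<^sup>+z. ennreal (std_normal_density z * exp (s * l i * z\<^sup>2)) \<partial>lborel)"
      unfolding g_def by (subst nn_integral_cmult[symmetric]) (simp_all add: ennreal_mult')
    also have "\<dots> = ennreal (exp (- (s * l i))) * ennreal (1 / sqrt (1 - 2 * (s * l i)))"
      by (simp only: nn_integral_normal_exp_square[OF s[of i]])
    finally show ?thesis by (simp add: ennreal_mult'[symmetric])
  qed
  have "ennreal (std_gaussian_density v) * ennreal (exp (s * chaos A v))
      = (\<Prod>i\<in>UNIV. g i ((Q *v v) $ i))" for v
  proof -
    have "std_gaussian_density v = (\<Prod>i\<in>UNIV. std_normal_density ((Q *v v) $ i))"
      using std_gaussian_density_eq_prod[of "Q *v v"] by (simp add: std_gaussian_density_def norm)
    moreover have "exp (s * chaos A v)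
        = (\<Prod>i\<in>UNIV. exp (- (s * l i)) * exp (s * l i * ((Q *v v) $ i)\<^sup>2))"
      unfolding chaos sum_distrib_left exp_sum[OF finite]
      by (simp add: exp_add[symmetric] algebra_simps)
    moreover have "0 \<le> (\<Prod>i\<in>UNIV. std_normal_density ((Q *v v) $ i))"
      by (simp add: prod_nonneg)
    ultimately show ?thesis
      by (simp add: g_def prod_ennreal ennreal_mult'[symmetric] prod.distrib[symmetric] mult_ac)
  qed
  then have "(\<integral>\<^sup>+v. ennreal (std_gaussian_density v) * ennreal (exp (s * chaos A v)) \<partial>lborel)
      = (\<integral>\<^sup>+v. (\<Prod>i\<in>UNIV. g i ((Q *v v) $ i)) \<partial>lborel)" by simp
  also have "\<dots> = (\<integral>\<^sup>+y. (\<Prod>i\<in>UNIV. g i (y $ i)) \<partial>(lborel :: (real ^ 'n) measure))"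
    by (rule nn_integral_lborel_orthogonal_transformation[OF T]) (simp add: g_def)
  also have "\<dots> = (\<Prod>i\<in>UNIV. \<integral>\<^sup>+z. g i z \<partial>lborel)"
    by (rule nn_integral_lborel_vec_prod) (simp add: g_def)
  also have "\<dots> = (\<Prod>i\<in>UNIV. ennreal (exp (- (s * l i)) / sqrt (1 - 2 * (s * l i))))"
    by (simp only: factor)
  also have "\<dots> = ennreal (\<Prod>i\<in>UNIV. exp (- (s * l i)) / sqrt (1 - 2 * (s * l i)))"
    using s by (intro prod_ennreal) (simp add: less_imp_le)
  finally show ?thesis .
qed

text \<open>
  Each factor is \<open>exp (- ln (1 - w) / 2 - w / 2)\<close> with \<open>w = u * l i / \<alpha>\<close> in \<open>[0, u]\<close>. Weakening
  \<open>1 - a * w\<close> to \<open>1 - a * u\<close> makes the exponents add up to a multiple of the sum of squares.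
\<close>
lemma mgf_product_le:
  fixes l :: "'i \<Rightarrow> real"
  assumes a: "2 / 3 < a" "a < 1" and u: "0 \<le> u" "u \<le> b_coeff a" and \<alpha>: "0 < \<alpha>"
    and I: "finite I" and l: "\<And>i. i \<in> I \<Longrightarrow> 0 \<le> l i" "\<And>i. i \<in> I \<Longrightarrow> l i \<le> \<alpha>"
  defines "s \<equiv> u / (2 * \<alpha>)"
  shows "(\<Prod>i\<in>I. exp (- (s * l i)) / sqrt (1 - 2 * (s * l i)))
    \<le> exp (u\<^sup>2 * (\<Sum>i\<in>I. (l i)\<^sup>2) / (4 * (1 - a * u) * \<alpha>\<^sup>2))"
proof -
  have u1: "u < 1" using u b_coeff_bounds(2)[OF a] by simp
  then have au: "a * u < 1" using mult_strict_mono'[of a 1 u 1] u a by simp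
  have factor: "0 \<le> exp (- (s * l i)) / sqrt (1 - 2 * (s * l i)) \<and>
    exp (- (s * l i)) / sqrt (1 - 2 * (s * l i)) \<le> exp (u\<^sup>2 * (l i)\<^sup>2 / (4 * (1 - a * u) * \<alpha>\<^sup>2))"
    if i: "i \<in> I" for i
  proof -
    define w where "w = u * (l i / \<alpha>)"
    have w2: "2 * (s * l i) = w" "s * l i = w / 2" by (simp_all add: w_def s_def)
    have w0: "0 \<le> w" using l(1)[OF i] u \<alpha> by (simp add: w_def)
    have "w \<le> u * 1" unfolding w_def using l(2)[OF i] u \<alpha> by (intro mult_left_mono) auto
    then have wu: "w \<le> u" by simp
    then have w1: "w < 1" using u1 by simp
    have "exp (- (s * l i)) / sqrt (1 - 2 * (s * l i)) = exp (- ln (1 - w) / 2 - w / 2)"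
    proof -
      have "sqrt (1 - w) = exp (ln (1 - w) / 2)"
        using w1 by (simp add: powr_half_sqrt[symmetric] powr_def)
      then show ?thesis unfolding w2 by (simp add: exp_diff[symmetric])
    qed
    also have "\<dots> \<le> exp (w\<^sup>2 / (4 * (1 - a * w)))"
      using neg_log_bound[OF a w0] wu u by simp
    also have "\<dots> \<le> exp (w\<^sup>2 / (4 * (1 - a * u)))"
    proof -
      have "a * w \<le> a * u" using wu a by simp
      then have "w\<^sup>2 / (4 * (1 - a * w)) \<le> w\<^sup>2 / (4 * (1 - a * u))"
        using au by (intro divide_left_mono) auto
      then show ?thesis by simp
    qed
    also have "w\<^sup>2 / (4 * (1 - a * u)) = u\<^sup>2 * (l i)\<^sup>2 / (4 * (1 - a * u) * \<alpha>\<^sup>2)"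
      by (simp add: w_def power_mult_distrib power_divide)
    finally show ?thesis using w1 by (simp add: w2)
  qed
  have "(\<Prod>i\<in>I. exp (- (s * l i)) / sqrt (1 - 2 * (s * l i)))
      \<le> (\<Prod>i\<in>I. exp (u\<^sup>2 * (l i)\<^sup>2 / (4 * (1 - a * u) * \<alpha>\<^sup>2)))"
    using factor by (intro prod_mono) auto
  also have "\<dots> = exp (\<Sum>i\<in>I. u\<^sup>2 * (l i)\<^sup>2 / (4 * (1 - a * u) * \<alpha>\<^sup>2))"
    by (rule exp_sum[OF I, symmetric])
  also have "(\<Sum>i\<in>I. u\<^sup>2 * (l i)\<^sup>2 / (4 * (1 - a * u) * \<alpha>\<^sup>2))
      = u\<^sup>2 * (\<Sum>i\<in>I. (l i)\<^sup>2) / (4 * (1 - a * u) * \<alpha>\<^sup>2)"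
    by (simp add: sum_distrib_left sum_divide_distrib)
  finally show ?thesis .
qed

lemma chaos_measurable: "chaos A \<in> borel_measurable borel"
  unfolding chaos_def[abs_def]
  by (intro borel_measurable_continuous_onI continuous_on_diff continuous_on_inner continuous_on_id
      continuous_on_const linear_continuous_on matrix_vector_mul_bounded_linear)

lemma chaos_Chernoff_bound:
  fixes A :: "real ^ 'n ^ 'n" and x :: "'m \<Rightarrow> real ^ 'n"
  assumes "A \<noteq> 0" "pos_semidef A" "prob_space M"
    and X: "distributed M lborel x (\<lambda>v. ennreal (std_gaussian_density v))"
    and a: "2 / 3 < a" "a < 1" and u: "0 < u" "u \<le> b_coeff a"
  defines "\<alpha> \<equiv> op_norm A" and "\<beta> \<equiv> (hs_norm A)\<^sup>2"
  shows "\<P>(\<omega> in M. chaos A (x \<omega>) > t) \<le> exp (- u * t / (2 * \<alpha>) + u\<^sup>2 * \<beta> / (4 * (1 - a * u) * \<alpha>\<^sup>2))"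
proof -
  interpret prob_space M by fact
  obtain Q :: "real ^ 'n ^ 'n" and l where Q: "orthogonal_matrix Q"
    and A: "A = transpose Q ** diag_matrix l ** Q"
    and l: "\<And>i. 0 \<le> l i" "\<And>i. l i \<le> \<alpha>"
    using pos_semidef_spectrum[OF \<open>pos_semidef A\<close>] unfolding \<alpha>_def by blast
  have \<alpha>: "0 < \<alpha>" using \<open>A \<noteq> 0\<close> by (simp add: \<alpha>_def op_norm_pos)
  have \<beta>: "\<beta> = (\<Sum>i\<in>UNIV. (l i)\<^sup>2)"
    unfolding \<beta>_def A by (rule hs_norm_square_conjugate_diag[OF Q])
  define s where "s = u / (2 * \<alpha>)"
  have s0: "0 < s" using u \<alpha> by (simp add: s_def)
  have sl: "2 * (s * l i) < 1" for i
  proof -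
    have "2 * (s * l i) \<le> 2 * (s * \<alpha>)" using l s0 by simp
    also have "\<dots> = u" using \<alpha> by (simp add: s_def)
    finally show ?thesis using u b_coeff_bounds(2)[OF a] by simp
  qed
  have x[measurable]: "x \<in> M \<rightarrow>\<^sub>M borel"
    using distributed_measurable[OF X] by simp
  note [measurable] = chaos_measurable[of A]
  have "(\<integral>\<^sup>+\<omega>. ennreal (exp (s * chaos A (x \<omega>))) \<partial>M)
      = (\<integral>\<^sup>+v. ennreal (std_gaussian_density v) * ennreal (exp (s * chaos A v)) \<partial>lborel)"
    by (rule distributed_nn_integral[OF X, symmetric]) measurable
  also have "\<dots> = ennreal (\<Prod>i\<in>UNIV. exp (- (s * l i)) / sqrt (1 - 2 * (s * l i)))"
    by (rule gaussian_chaos_mgf[OF Q A sl])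
  also have "\<dots> \<le> ennreal (exp (u\<^sup>2 * \<beta> / (4 * (1 - a * u) * \<alpha>\<^sup>2)))"
    unfolding s_def \<beta> using l u \<alpha> by (intro ennreal_leI mgf_product_le[OF a]) auto
  finally have mgf: "(\<integral>\<^sup>+\<omega>. ennreal (exp (s * chaos A (x \<omega>))) \<partial>M)
      \<le> ennreal (exp (u\<^sup>2 * \<beta> / (4 * (1 - a * u) * \<alpha>\<^sup>2)))" .
  have "ennreal (\<P>(\<omega> in M. chaos A (x \<omega>) > t)) \<le> emeasure M {\<omega> \<in> space M. t \<le> chaos A (x \<omega>)}"
    unfolding emeasure_eq_measure[symmetric] by (intro emeasure_mono) auto
  also have "\<dots> \<le> ennreal (exp (- s * t)) *
      (\<integral>\<^sup>+\<omega>. ennreal (exp (s * chaos A (x \<omega>))) * indicator (space M) \<omega> \<partial>M)"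
    by (rule Chernoff_ineq_nn_integral_ge[OF s0]) measurable
  also have "(\<integral>\<^sup>+\<omega>. ennreal (exp (s * chaos A (x \<omega>))) * indicator (space M) \<omega> \<partial>M)
      = (\<integral>\<^sup>+\<omega>. ennreal (exp (s * chaos A (x \<omega>))) \<partial>M)"
    by (intro nn_integral_cong) simp
  also have "ennreal (exp (- s * t)) * \<dots>
      \<le> ennreal (exp (- s * t)) * ennreal (exp (u\<^sup>2 * \<beta> / (4 * (1 - a * u) * \<alpha>\<^sup>2)))"
    by (intro mult_left_mono mgf) simp
  also have "\<dots> = ennreal (exp (- u * t / (2 * \<alpha>) + u\<^sup>2 * \<beta> / (4 * (1 - a * u) * \<alpha>\<^sup>2)))"
    by (simp add: ennreal_mult[symmetric] exp_add[symmetric] s_def)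
  finally show ?thesis by simp
qed

theorem proposition2:
  fixes A :: "real ^ 'n ^ 'n"
    and M :: "'m measure"
    and x :: "'m \<Rightarrow> real ^ 'n"
    and a t :: real
  assumes "A \<noteq> 0"
    and "pos_semidef A"
    and "prob_space M"
    and "distributed M lborel x (\<lambda>v. ennreal (std_gaussian_density v))"
    and "2 / 3 < a" and "a < 1"
    and "0 < t"
  shows "\<P>(\<omega> in M. chaos A (x \<omega>) > t) \<le> exp (Lambda (op_norm A) ((hs_norm A)\<^sup>2) t a)"
proof -
  define \<alpha> \<beta> where "\<alpha> = op_norm A" and "\<beta> = (hs_norm A)\<^sup>2"
  note a = \<open>2 / 3 < a\<close> \<open>a < 1\<close>
  have \<alpha>: "0 < \<alpha>" using \<open>A \<noteq> 0\<close> by (simp add: \<alpha>_def op_norm_pos)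
  have \<beta>: "0 < \<beta>" using \<open>A \<noteq> 0\<close> by (simp add: \<beta>_def hs_norm_eq_norm)
  note Chernoff = chaos_Chernoff_bound[OF assms(1-6), of _ t, folded \<alpha>_def \<beta>_def]
  show ?thesis
  proof (cases "\<alpha> * t / \<beta> \<le> c_coeff a")
    case True
    define u where "u = (1 - 1 / sqrt (1 + 2 * a * \<alpha> * t / \<beta>)) / a"
    have \<tau>: "0 < \<alpha> * t / \<beta>" "2 * a * \<alpha> * t / \<beta> = 2 * a * (\<alpha> * t / \<beta>)"
      using \<alpha> \<beta> \<open>0 < t\<close> by auto
    have "0 < 2 * a * \<alpha> * t / \<beta>" using \<alpha> \<beta> a \<open>0 < t\<close> by simp
    then have "0 < u" using a by (simp add: u_def)
    moreover have "u \<le> b_coeff a"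
      unfolding u_def \<tau>(2) by (rule chernoff_minimiser_le_b_coeff[OF a \<tau>(1) True])
    ultimately show ?thesis
      using Chernoff[of u] chernoff_exponent_at_minimiser[OF \<alpha> \<beta> _ \<open>0 < t\<close>, of a] a True
      by (simp add: Lambda_def u_def flip: \<alpha>_def \<beta>_def)
  next
    case False
    then show ?thesis
      using Chernoff[OF b_coeff_bounds(1)[OF a] order_refl]
      by (simp add: Lambda_def flip: \<alpha>_def \<beta>_def)
  qed
qed

end
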